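(* Let $n\ge1$, $m\ge0$ and let $0$ be the all-zero vertex of the dYoke graph $Z_{n,m}$. Then $\operatorname{ecc}_{Z_{n,m}}(0)=\operatorname{ecc}_{Y_{n,m}}(0)$; explicitly: (1) if $n=1$, $\operatorname{ecc}_{Z_{n,m}}(0)=\binom{\lceil m/2\rceil+1}{2}+\binom{\lfloor m/2\rfloor+1}{2}$; (2) if $0\le m\le n$, $\operatorname{ecc}_{Z_{n,m}}(0)=\lfloor n(m+1)/2\rfloor$; (3) if $2\le n\le m$, with $d_0=\binom{\lfloor (m+n)/2\rfloor+1}{2}+\binom{\lceil (m-n)/2\rceil+1}{2}$: (a) if $2\mid(m-n)$ or $n\le\lceil (m+1)/2\rceil$, then $\operatorname{ecc}_{Z_{n,m}}(0)=d_0$; (b) otherwise $\operatorname{ecc}_{Z_{n,m}}(0)=d_0+n-\lceil (m+1)/2\rceil$.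
   Context: For integers $n\ge1$, $m\ge0$, the Yoke graph $Y_{n,m}$ has vertices the tuples $v=(v_0,\dots,v_{m+1})$ with $v_0,v_{m+1}\in\mathbb{Z}_n$, $v_1,\dots,v_m\in\{0,1\}$, $\sum v_i\equiv0\pmod n$; the dYoke graph $Z_{n,m}$ is defined identically but with $v_1,\dots,v_m\in\{-1,0,1\}$. In both, $u\sim v$ iff there is $0\le i\le m$ with $u_j=v_j$ for $j\notin\{i,i+1\}$ and either ($u_i=v_i+1$, $u_{i+1}=v_{i+1}-1$) or ($u_i=v_i-1$, $u_{i+1}=v_{i+1}+1$), bucket entries (indices $0,m+1$) computed modulo $n$. $\operatorname{ecc}_G(x)$ is the maximum distance from $x$ to a vertex of $G$. *)

theory Defs
  imports Main "HOL-Library.Extended_Nat"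
begin

text \<open>Vertices are integer lists v = [v_0, ..., v_(m+1)] of length m+2.
  Bucket entries v_0, v_(m+1) are residues in {0..n-1}; the middle entries
  range over the set S ({0,1} for the Yoke graph, {-1,0,1} for the dYoke graph).\<close>

definition gen_verts :: "nat \<Rightarrow> nat \<Rightarrow> int set \<Rightarrow> int list set" where
  "gen_verts n m S = {v. length v = m + 2 \<and> v ! 0 \<in> {0..<int n} \<and> v ! (m+1) \<in> {0..<int n}
      \<and> (\<forall>i\<in>{1..m}. v ! i \<in> S) \<and> sum_list v mod int n = 0}"

definition entry_eq :: "nat \<Rightarrow> nat \<Rightarrow> nat \<Rightarrow> int \<Rightarrow> int \<Rightarrow> bool" where
  "entry_eq n m k a b = (if k = 0 \<or> k = m + 1 then a mod int n = b mod int n else a = b)"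

definition gen_adj :: "nat \<Rightarrow> nat \<Rightarrow> int set \<Rightarrow> int list \<Rightarrow> int list \<Rightarrow> bool" where
  "gen_adj n m S u v = (u \<in> gen_verts n m S \<and> v \<in> gen_verts n m S \<and>
     (\<exists>i\<le>m. (\<forall>j<m+2. j \<noteq> i \<and> j \<noteq> i + 1 \<longrightarrow> u ! j = v ! j) \<and>
        ((entry_eq n m i (u ! i) (v ! i + 1) \<and> entry_eq n m (i+1) (u ! (i+1)) (v ! (i+1) - 1)) \<or>
         (entry_eq n m i (u ! i) (v ! i - 1) \<and> entry_eq n m (i+1) (u ! (i+1)) (v ! (i+1) + 1)))))"

definition yoke_verts :: "nat \<Rightarrow> nat \<Rightarrow> int list set" where
  "yoke_verts n m = gen_verts n m {0, 1}"
definition yoke_adj :: "nat \<Rightarrow> nat \<Rightarrow> int list \<Rightarrow> int list \<Rightarrow> bool" where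
  "yoke_adj n m = gen_adj n m {0, 1}"
definition dyoke_verts :: "nat \<Rightarrow> nat \<Rightarrow> int list set" where
  "dyoke_verts n m = gen_verts n m {-1, 0, 1}"
definition dyoke_adj :: "nat \<Rightarrow> nat \<Rightarrow> int list \<Rightarrow> int list \<Rightarrow> bool" where
  "dyoke_adj n m = gen_adj n m {-1, 0, 1}"

definition graph_dist :: "('a \<Rightarrow> 'a \<Rightarrow> bool) \<Rightarrow> 'a \<Rightarrow> 'a \<Rightarrow> enat" where
  "graph_dist E x y = (if \<exists>k. (E ^^ k) x y then enat (LEAST k. (E ^^ k) x y) else \<infinity>)"

definition ecc :: "'a set \<Rightarrow> ('a \<Rightarrow> 'a \<Rightarrow> bool) \<Rightarrow> 'a \<Rightarrow> enat" where
  "ecc V E x = (SUP y\<in>V. graph_dist E x y)"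

definition zero_vertex :: "nat \<Rightarrow> int list" where
  "zero_vertex m = replicate (m + 2) 0"

end

(*
  The prefix sums s_0, ..., s_m of a vertex determine it, and they are themselves determined up to
  adding a common multiple of n. An edge changes a single s_i by one, so the distance from 0 is at
  least the minimum over k of the sum of |s_i + k n|; it is attained because an extremal entry can
  always be moved towards zero. Sorting s preserves this quantity and turns a dYoke vertex into a
  Yoke vertex. It remains to maximise over nondecreasing s with steps 0, 1. Translate so that the
  median lies in [0, n), and let p and q be the numbers of entries below 0 and above n. If p and q
  are both at most (m - n) / 2, average the distances to 0 and to n; otherwise, say for p,
  the distance to 0 is at most T(p) + T(m - p), where T(x) = x (x + 1) / 2.
*)

theory Submission
  imports Defs "HOL-Library.Multiset"
begin

section \<open>Vertices encoded by integer prefix sums\<close>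

text \<open>\<open>s\<close> lifts the prefix sums to the integers; only its values at 0, ..., m are
  read. The last bucket is forced, since the other entries add up to \<open>s m\<close> modulo
  n.\<close>

definition vertex_of :: "nat \<Rightarrow> nat \<Rightarrow> (nat \<Rightarrow> int) \<Rightarrow> int list" where
  "vertex_of n m s = map (\<lambda>j. if j = 0 then s 0 mod int n
     else if j = m + 1 then (- s m) mod int n else s j - s (j - 1)) [0..<m + 2]"

definition steps_in :: "nat \<Rightarrow> int set \<Rightarrow> (nat \<Rightarrow> int) \<Rightarrow> bool" where
  "steps_in m S s \<longleftrightarrow> (\<forall>i<m. s (Suc i) - s i \<in> S)"

lemma length_vertex_of [simp]: "length (vertex_of n m s) = m + 2"
  by (simp add: vertex_of_def)

lemma nth_vertex_of:
  "j < m + 2 \<Longrightarrow> vertex_of n m s ! j = (if j = 0 then s 0 mod int n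
     else if j = m + 1 then (- s m) mod int n else s j - s (j - 1))"
  unfolding vertex_of_def by (subst nth_map) (auto simp del: upt_Suc)

lemma vertex_of_eqI:
  assumes "length w = m + 2" "w ! 0 \<in> {0..<int n}" "w ! (m + 1) \<in> {0..<int n}"
    and "w ! 0 mod int n = s 0 mod int n" "w ! (m + 1) mod int n = (- s m) mod int n"
    and "\<And>j. \<lbrakk>1 \<le> j; j \<le> m\<rbrakk> \<Longrightarrow> w ! j = s j - s (j - 1)"
  shows "w = vertex_of n m s"
proof (rule nth_equalityI)
  fix j assume "j < length w"
  then consider "j = 0" | "j = m + 1" | "1 \<le> j" "j \<le> m" using assms(1) by fastforce
  then show "w ! j = vertex_of n m s ! j"
    using assms by cases (auto simp: nth_vertex_of)
qed (simp add: assms(1))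

lemma sum_list_telescope:
  fixes s :: "nat \<Rightarrow> int"
  assumes "\<And>j. \<lbrakk>1 \<le> j; j \<le> m\<rbrakk> \<Longrightarrow> w ! j = s j - s (j - 1)" "length w = m + 2"
  shows "sum_list w = w ! 0 + (s m - s 0) + w ! (m + 1)"
proof -
  have "k \<le> m \<Longrightarrow> (\<Sum>j\<in>{..k}. w ! j) = w ! 0 + (s k - s 0)" for k
  proof (induction k)
    case (Suc k) then show ?case using assms(1)[of "Suc k"] by simp
  qed simp
  moreover have "sum_list w = (\<Sum>j\<in>{..m}. w ! j) + w ! (m + 1)"
    by (simp add: sum_list_sum_nth assms(2) atLeast0LessThan lessThan_Suc_atMost del: sum.lessThan_Suc)
  ultimately show ?thesis by simp
qed

text \<open>The ranges of the buckets and the vanishing of the total modulo n hold for every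
  \<open>s\<close>, so only the increments decide membership.\<close>

lemma vertex_of_in_gen_verts:
  assumes "n \<ge> 1"
  shows "vertex_of n m s \<in> gen_verts n m S \<longleftrightarrow> steps_in m S s"
proof -
  have "sum_list (vertex_of n m s) = s 0 mod int n + (s m - s 0) + (- s m) mod int n"
    by (subst sum_list_telescope[where s = s and m = m]) (auto simp: nth_vertex_of)
  also have "\<dots> mod int n = (s 0 + (s m - s 0) + (- s m)) mod int n"
    by (metis mod_add_left_eq mod_add_right_eq)
  finally have "sum_list (vertex_of n m s) mod int n = 0" by simp
  moreover have "(\<forall>i\<in>{1..m}. vertex_of n m s ! i \<in> S) \<longleftrightarrow> steps_in m S s"
  proof -
    have "(\<forall>i\<in>{1..m}. P i) \<longleftrightarrow> (\<forall>i<m. P (Suc i))" for P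
      by (metis One_nat_def Suc_le_eq Suc_le_mono atLeastAtMost_iff le0 not0_implies_Suc not_less_eq_eq)
    then show ?thesis by (simp add: steps_in_def nth_vertex_of)
  qed
  ultimately show ?thesis using assms by (auto simp: gen_verts_def nth_vertex_of)
qed

lemma gen_verts_lift:
  assumes "v \<in> gen_verts n m S"
  obtains s where "v = vertex_of n m s"
proof
  define s where "s i = (\<Sum>j\<le>i. v ! j)" for i
  have len: "length v = m + 2" and mod0: "sum_list v mod int n = 0"
    using assms by (auto simp: gen_verts_def)
  have diff: "v ! j = s j - s (j - 1)" if "1 \<le> j" "j \<le> m" for j
    using that by (cases j) (auto simp: s_def)
  have "sum_list v = v ! 0 + (s m - s 0) + v ! (m + 1)"
    by (rule sum_list_telescope[OF diff len])
  then have "sum_list v = s m + v ! (m + 1)" by (simp add: s_def)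
  then have "v ! (m + 1) mod int n = (- s m) mod int n"
    using mod0 by (metis add.commute diff_minus_eq_add mod_eq_dvd_iff mod_0_imp_dvd)
  then show "v = vertex_of n m s"
    using assms len diff by (intro vertex_of_eqI) (auto simp: gen_verts_def s_def)
qed

lemma vertex_of_shift:
  "vertex_of n m (\<lambda>i. s i + k * int n) = vertex_of n m s"
proof -
  have "(- (s m + k * int n)) mod int n = (- s m) mod int n"
    by (simp add: mod_eq_dvd_iff)
  then show ?thesis by (simp add: vertex_of_def)
qed

text \<open>Equal middle entries give equal increments, so two lifts differ by a constant on 0, ...,
  m, and the first bucket makes it a multiple of n. With \<open>vertex_of_shift\<close> this
  describes all lifts of a vertex.\<close>

lemma vertex_of_eqD:
  assumes "vertex_of n m s = vertex_of n m t"
  obtains k where "\<And>i. i \<le> m \<Longrightarrow> t i = s i + k * int n"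
proof -
  have nth: "vertex_of n m s ! j = vertex_of n m t ! j" for j
    using assms by simp
  have "s 0 mod int n = t 0 mod int n"
    using nth[of 0] by (simp add: nth_vertex_of)
  then obtain k where k: "t 0 = s 0 + k * int n"
    by (metis mod_eq_dvd_iff dvd_def add.commute diff_add_cancel mult.commute)
  have "i \<le> m \<Longrightarrow> t i = s i + k * int n" for i
  proof (induction i)
    case (Suc i) then show ?case using nth[of "Suc i"] by (auto simp: nth_vertex_of)
  qed (use k in simp)
  then show ?thesis by (rule that)
qed

lemma zero_vertex_eq: "zero_vertex m = vertex_of n m (\<lambda>_. 0)"
  unfolding zero_vertex_def by (rule nth_equalityI) (auto simp: nth_vertex_of simp del: replicate_Suc)

section \<open>Walks from the zero vertex and the size of lifts\<close>

text \<open>Changing \<open>s i\<close> by e changes the entries at i and i + 1 by e and -e, modulo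
  n where the entry is a bucket. That is an edge.\<close>

lemma gen_adj_vertex_of:
  assumes "n \<ge> 1" "steps_in m S s" "steps_in m S (s(i := s i + e))" "i \<le> m" "e \<in> {1, -1}"
  shows "gen_adj n m S (vertex_of n m (s(i := s i + e))) (vertex_of n m s)"
proof -
  let ?u = "vertex_of n m (s(i := s i + e))" and ?v = "vertex_of n m s"
  have "?u ! j = ?v ! j" if "j < m + 2" "j \<noteq> i" "j \<noteq> i + 1" for j
    using that \<open>i \<le> m\<close> by (auto simp: nth_vertex_of)
  moreover have "entry_eq n m i (?u ! i) (?v ! i + e)"
    using \<open>i \<le> m\<close> by (auto simp: entry_eq_def nth_vertex_of mod_simps)
  moreover have "entry_eq n m (i + 1) (?u ! (i + 1)) (?v ! (i + 1) - e)"
    using \<open>i \<le> m\<close> by (auto simp: entry_eq_def nth_vertex_of mod_simps)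
  ultimately show ?thesis
    using assms by (auto simp: gen_adj_def vertex_of_in_gen_verts intro!: exI[of _ i])
qed

text \<open>The converse of \<open>gen_adj_vertex_of\<close>, for an arbitrary lift of one endpoint.
  This is what allows a walk to be lifted edge by edge.\<close>

lemma gen_adj_lift:
  assumes adj: "gen_adj n m S (vertex_of n m s) w"
  obtains i e where "i \<le> m" "e \<in> {1, -1}" "w = vertex_of n m (s(i := s i + e))"
proof -
  let ?v = "vertex_of n m s"
  have w: "w \<in> gen_verts n m S" using adj by (simp add: gen_adj_def)
  obtain i e where i: "i \<le> m" and e: "e \<in> {1, -1}"
    and same: "\<And>j. \<lbrakk>j < m + 2; j \<noteq> i; j \<noteq> i + 1\<rbrakk> \<Longrightarrow> ?v ! j = w ! j"
    and ei: "entry_eq n m i (?v ! i) (w ! i - e)"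
    and ei1: "entry_eq n m (i + 1) (?v ! (i + 1)) (w ! (i + 1) + e)"
  proof -
    obtain i where "i \<le> m" "\<And>j. \<lbrakk>j < m + 2; j \<noteq> i; j \<noteq> i + 1\<rbrakk> \<Longrightarrow> ?v ! j = w ! j"
      and "(entry_eq n m i (?v ! i) (w ! i - (-1)) \<and> entry_eq n m (i + 1) (?v ! (i + 1)) (w ! (i + 1) + (-1)))
        \<or> (entry_eq n m i (?v ! i) (w ! i - 1) \<and> entry_eq n m (i + 1) (?v ! (i + 1)) (w ! (i + 1) + 1))"
      using adj unfolding gen_adj_def by auto
    then show ?thesis using that[of i 1] that[of i "-1"] by blast
  qed
  have "w = vertex_of n m (s(i := s i + e))"
  proof (rule vertex_of_eqI)
    show "w ! 0 mod int n = (s(i := s i + e)) 0 mod int n"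
    proof (cases "i = 0")
      case True
      then have "s 0 mod int n = (w ! 0 - e) mod int n"
        using ei by (simp add: entry_eq_def nth_vertex_of)
      then have "(s 0 + e) mod int n = (w ! 0 - e + e) mod int n" by (rule mod_add_cong) simp
      then show ?thesis using True by simp
    next
      case False
      then have "w ! 0 = s 0 mod int n" using same[of 0] by (simp add: nth_vertex_of)
      then show ?thesis using False by simp
    qed
    show "w ! (m + 1) mod int n = - (s(i := s i + e)) m mod int n"
    proof (cases "i = m")
      case True
      then have "(- s m) mod int n = (w ! (m + 1) + e) mod int n"
        using ei1 by (simp add: entry_eq_def nth_vertex_of)
      then have "(- s m - e) mod int n = (w ! (m + 1) + e - e) mod int n" by (rule mod_diff_cong) simp
      then show ?thesis using True by simp
    next
      case False
      then have "w ! (m + 1) = (- s m) mod int n"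
        using same[of "m + 1"] i by (simp add: nth_vertex_of)
      then show ?thesis using False by simp
    qed
    fix j assume j: "1 \<le> j" "j \<le> m"
    consider "j = i" | "j = i + 1" | "j \<noteq> i" "j \<noteq> i + 1" by blast
    then show "w ! j = (s(i := s i + e)) j - (s(i := s i + e)) (j - 1)"
    proof cases
      case 1 then show ?thesis using ei j by (auto simp: entry_eq_def nth_vertex_of)
    next
      case 2 then show ?thesis using ei1 j by (auto simp: entry_eq_def nth_vertex_of)
    next
      case 3 then show ?thesis using same[of j] j by (auto simp: nth_vertex_of)
    qed
  qed (use w in \<open>auto simp: gen_verts_def\<close>)
  with i e show ?thesis by (rule that)
qed

text \<open>The walk starts at the zero lift, and each edge changes one value by one, so the sum of
  absolute values grows by at most one per edge.\<close>

lemma walk_lift: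
  assumes "(gen_adj n m S ^^ k) (zero_vertex m) v"
  obtains s where "v = vertex_of n m s" "(\<Sum>i\<le>m. \<bar>s i\<bar>) \<le> int k"
proof -
  have "\<exists>s. v = vertex_of n m s \<and> (\<Sum>i\<le>m. \<bar>s i\<bar>) \<le> int k"
    using assms
  proof (induction k arbitrary: v)
    case 0
    then show ?case by (intro exI[of _ "\<lambda>_. 0"]) (simp add: zero_vertex_eq[of m n])
  next
    case (Suc k)
    from Suc.prems obtain u where "(gen_adj n m S ^^ k) (zero_vertex m) u" and uv: "gen_adj n m S u v"
      by auto
    with Suc.IH obtain s where s: "u = vertex_of n m s" "(\<Sum>i\<le>m. \<bar>s i\<bar>) \<le> int k" by blast
    obtain i e where ie: "i \<le> m" "e \<in> {1, -1}" "v = vertex_of n m (s(i := s i + e))"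
      using gen_adj_lift[OF uv[unfolded s(1)]] by blast
    have "(\<Sum>j\<le>m. \<bar>(s(i := s i + e)) j\<bar>) \<le> (\<Sum>j\<le>m. \<bar>s j\<bar> + (if j = i then 1 else 0))"
    proof (rule sum_mono)
      fix j
      have "\<bar>s i + e\<bar> \<le> \<bar>s i\<bar> + 1" using ie(2) by auto
      then show "\<bar>(s(i := s i + e)) j\<bar> \<le> \<bar>s j\<bar> + (if j = i then 1 else 0)" by simp
    qed
    also have "\<dots> = (\<Sum>j\<le>m. \<bar>s j\<bar>) + 1" using ie(1) by (simp add: sum.distrib)
    finally have "(\<Sum>j\<le>m. \<bar>(s(i := s i + e)) j\<bar>) \<le> int (Suc k)" using s(2) by simp
    with ie(3) show ?case by blast
  qed
  then show ?thesis using that by blast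
qed

text \<open>Only two properties of \<open>S\<close> matter: a positive step may be lowered and a nonpositive one raised.
  So the first maximum, if positive, and the last minimum, if negative, can be moved towards zero.\<close>

lemma step_towards_zero:
  assumes S: "S = {0, 1} \<or> S = {-1, 0, 1}" and s: "steps_in m S s" and "j \<le> m" "s j \<noteq> 0"
  obtains i e where "i \<le> m" "e \<in> {1, -1}" "\<bar>s i + e\<bar> = \<bar>s i\<bar> - 1" "steps_in m S (s(i := s i + e))"
proof -
  have down: "d - 1 \<in> S" if "d \<in> S" "d > 0" for d using S that by auto
  have up: "d + 1 \<in> S" if "d \<in> S" "d \<le> 0" for d using S that by auto
  consider "s j > 0" | "s j < 0" using \<open>s j \<noteq> 0\<close> by linarith
  then show ?thesis
  proof cases
    case 1
    define M where "M = Max (s ` {..m})"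
    have le: "s i \<le> M" if "i \<le> m" for i using that by (simp add: M_def)
    have "M \<in> s ` {..m}" unfolding M_def by (rule Max_in) auto
    then have ex: "\<exists>i. i \<le> m \<and> s i = M" by auto
    define i where "i = (LEAST i. i \<le> m \<and> s i = M)"
    have i: "i \<le> m" "s i = M" using LeastI_ex[OF ex] by (auto simp: i_def)
    \<comment> \<open>Being first makes the step into \<open>i\<close> positive; being maximal makes
      the step out of \<open>i\<close> nonpositive. Lowering \<open>s i\<close> lowers the former
      and raises the latter.\<close>
    have less: "s k < s i" if "k < i" for k
      using not_less_Least[of k "\<lambda>i. i \<le> m \<and> s i = M"] that i le[of k] unfolding i_def[symmetric]
      by fastforce
    have "steps_in m S (s(i := s i + -1))"
      unfolding steps_in_def
    proof (intro allI impI)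
      fix k assume k: "k < m"
      have sk: "s (Suc k) - s k \<in> S" using s k by (simp add: steps_in_def)
      consider "k = i" | "Suc k = i" | "k \<noteq> i" "Suc k \<noteq> i" by blast
      then show "(s(i := s i + -1)) (Suc k) - (s(i := s i + -1)) k \<in> S"
      proof cases
        case 1 then show ?thesis using up[OF sk] le[of "Suc k"] k i by (simp add: algebra_simps)
      next
        case 2 then show ?thesis using down[OF sk] less[of k] by (auto simp: algebra_simps)
      qed (use sk in simp)
    qed
    moreover have "M > 0" using le[OF \<open>j \<le> m\<close>] 1 by linarith
    ultimately show ?thesis using i by (intro that[of i "-1"]) auto
  next
    case 2
    define M where "M = Min (s ` {..m})"
    have le: "s i \<ge> M" if "i \<le> m" for i using that by (simp add: M_def)
    have "M \<in> s ` {..m}" unfolding M_def by (rule Min_in) auto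
    then have ex: "\<exists>i. i \<le> m \<and> s i = M" by auto
    define i where "i = (GREATEST i. i \<le> m \<and> s i = M)"
    have i: "i \<le> m" "s i = M" using GreatestI_ex_nat[OF ex, of m] by (auto simp: i_def)
    have less: "s k > s i" if "k > i" "k \<le> m" for k
      using Greatest_le_nat[of "\<lambda>i. i \<le> m \<and> s i = M" k m] that i le[of k] unfolding i_def[symmetric]
      by fastforce
    have "steps_in m S (s(i := s i + 1))"
      unfolding steps_in_def
    proof (intro allI impI)
      fix k assume k: "k < m"
      have sk: "s (Suc k) - s k \<in> S" using s k by (simp add: steps_in_def)
      consider "k = i" | "Suc k = i" | "k \<noteq> i" "Suc k \<noteq> i" by blast
      then show "(s(i := s i + 1)) (Suc k) - (s(i := s i + 1)) k \<in> S"
      proof cases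
        case 1 then show ?thesis using down[OF sk] less[of "Suc k"] k by (simp add: algebra_simps)
      next
        case 2 then show ?thesis using up[OF sk] le[of k] k i by (auto simp: algebra_simps)
      qed (use sk in simp)
    qed
    moreover have "M < 0" using le[OF \<open>j \<le> m\<close>] 2 by linarith
    ultimately show ?thesis using i by (intro that[of i 1]) auto
  qed
qed

text \<open>Induction on the sum of absolute values, with \<open>step_towards_zero\<close> supplying
  the penultimate vertex. With \<open>walk_lift\<close> this makes the distance from 0 the least
  such sum over all lifts.\<close>

lemma walk_to_vertex_of:
  assumes "n \<ge> 1" and S: "S = {0, 1} \<or> S = {-1, 0, 1}"
    and "steps_in m S s" "(\<Sum>i\<le>m. \<bar>s i\<bar>) = int k"
  shows "(gen_adj n m S ^^ k) (zero_vertex m) (vertex_of n m s)"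
  using assms(3,4)
proof (induction k arbitrary: s)
  case 0
  then have "s i = 0" if "i \<le> m" for i
    using that sum_nonneg_eq_0_iff[of "{..m}" "\<lambda>i. \<bar>s i\<bar>"] by auto
  then have "vertex_of n m s = zero_vertex m"
    unfolding zero_vertex_eq[of m n] by (intro nth_equalityI) (auto simp: nth_vertex_of)
  then show ?case by simp
next
  case (Suc k)
  have "\<exists>j\<le>m. s j \<noteq> 0"
  proof (rule ccontr)
    assume "\<not> ?thesis"
    then have "(\<Sum>i\<le>m. \<bar>s i\<bar>) = 0" by (intro sum.neutral) auto
    with Suc.prems show False by simp
  qed
  then obtain i e where i: "i \<le> m" and e: "e \<in> {1, -1}" and abs: "\<bar>s i + e\<bar> = \<bar>s i\<bar> - 1"
    and st: "steps_in m S (s(i := s i + e))"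
    using step_towards_zero[OF S Suc.prems(1)] by metis
  let ?t = "s(i := s i + e)"
  have "(\<Sum>j\<le>m. \<bar>?t j\<bar>) = (\<Sum>j\<le>m. \<bar>s j\<bar> - (if j = i then 1 else 0))"
    by (rule sum.cong) (use abs in auto)
  also have "\<dots> = int k" using i Suc.prems(2) by (simp add: sum_subtractf)
  finally have "(gen_adj n m S ^^ k) (zero_vertex m) (vertex_of n m ?t)"
    by (rule Suc.IH[OF st])
  moreover have "gen_adj n m S (vertex_of n m ?t) (vertex_of n m s)"
    by (rule gen_adj_vertex_of[OF assms(1) Suc.prems(1) st i e])
  ultimately show ?case by auto
qed

section \<open>Reduction to an extremal problem on integer sequences\<close>

lemma ecc_eqI:
  assumes upper: "\<And>v. v \<in> V \<Longrightarrow> \<exists>k\<le>b. (E ^^ k) x v"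
    and "y \<in> V" and lower: "\<And>k. (E ^^ k) x y \<Longrightarrow> b \<le> k"
  shows "ecc V E x = enat b"
proof (rule antisym)
  have "graph_dist E x v \<le> enat b" if v: "v \<in> V" for v
  proof -
    obtain k where k: "k \<le> b" "(E ^^ k) x v" using upper[OF v] by blast
    then have "(LEAST k. (E ^^ k) x v) \<le> k" by (intro Least_le)
    then show ?thesis using k by (auto simp: graph_dist_def)
  qed
  then show "ecc V E x \<le> enat b" unfolding ecc_def by (rule SUP_least)
  have "enat b \<le> graph_dist E x y"
    using lower by (auto simp: graph_dist_def intro: LeastI2_ex)
  then show "enat b \<le> ecc V E x"
    unfolding ecc_def using \<open>y \<in> V\<close> by (rule SUP_upper2[rotated])
qed

text \<open>Graphs disappear here: what remains is to maximise over \<open>s\<close> the minimum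
  over k of a shifted sum. The witness has steps in {0, 1}, which both choices of \<open>S\<close>
  contain, so one witness serves both graphs.\<close>

lemma ecc_gen_eqI:
  assumes "n \<ge> 1" and S: "S = {0, 1} \<or> S = {-1, 0, 1}"
    and upper: "\<And>s. steps_in m S s \<Longrightarrow> \<exists>k. (\<Sum>i\<le>m. \<bar>s i + k * int n\<bar>) \<le> int b"
    and w: "steps_in m {0, 1} w"
    and lower: "\<And>k. int b \<le> (\<Sum>i\<le>m. \<bar>w i + k * int n\<bar>)"
  shows "ecc (gen_verts n m S) (gen_adj n m S) (zero_vertex m) = enat b"
proof (rule ecc_eqI)
  fix v assume v: "v \<in> gen_verts n m S"
  then obtain s where vs: "v = vertex_of n m s" by (rule gen_verts_lift)
  then have s: "steps_in m S s" using v vertex_of_in_gen_verts assms(1) by blast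
  obtain k where k: "(\<Sum>i\<le>m. \<bar>s i + k * int n\<bar>) \<le> int b" using upper[OF s] by blast
  define c where "c = nat (\<Sum>i\<le>m. \<bar>s i + k * int n\<bar>)"
  have c: "(\<Sum>i\<le>m. \<bar>s i + k * int n\<bar>) = int c" by (simp add: c_def sum_nonneg)
  have "steps_in m S (\<lambda>i. s i + k * int n)" using s by (simp add: steps_in_def)
  from walk_to_vertex_of[OF assms(1) S this c]
  have "(gen_adj n m S ^^ c) (zero_vertex m) v" by (simp add: vs vertex_of_shift)
  then show "\<exists>k\<le>b. (gen_adj n m S ^^ k) (zero_vertex m) v" using c k by auto
next
  have "steps_in m S w" using w S by (auto simp: steps_in_def)
  then show "vertex_of n m w \<in> gen_verts n m S" using vertex_of_in_gen_verts assms(1) by blast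
next
  fix k assume "(gen_adj n m S ^^ k) (zero_vertex m) (vertex_of n m w)"
  then obtain s where s: "vertex_of n m w = vertex_of n m s" "(\<Sum>i\<le>m. \<bar>s i\<bar>) \<le> int k"
    by (rule walk_lift)
  from s(1) obtain c where c: "\<And>i. i \<le> m \<Longrightarrow> s i = w i + c * int n" by (rule vertex_of_eqD) blast
  have "(\<Sum>i\<le>m. \<bar>s i\<bar>) = (\<Sum>i\<le>m. \<bar>w i + c * int n\<bar>)" by (rule sum.cong) (auto simp: c)
  then show "b \<le> k" using lower[of c] s(2) by linarith
qed

section \<open>Sorting a sequence of prefix sums\<close>

text \<open>Sorting keeps the multiset of values, hence every sum of the form given. Steps of size
  at most one leave no gap in the set of values, so consecutive sorted values differ by 0 or
  1.\<close>

lemma sorted_rearrangement: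
  assumes s: "steps_in m S s" and S: "S \<subseteq> {-1, 0, 1}"
  obtains u where "steps_in m {0, 1} u"
    "\<And>g :: int \<Rightarrow> int. (\<Sum>i\<le>m. g (u i)) = (\<Sum>i\<le>m. g (s i))"
proof -
  define xs where "xs = sort (map s [0..<Suc m])"
  have len: "length xs = Suc m" by (simp add: xs_def)
  have set: "set xs = s ` {..m}"
    unfolding xs_def by (auto simp del: upt_Suc simp: image_iff)
  have lip: "\<bar>s (Suc i) - s i\<bar> \<le> 1" if "i < m" for i
  proof -
    have "s (Suc i) - s i \<in> {-1, 0, 1}" using s S that unfolding steps_in_def by blast
    then show ?thesis by auto
  qed
  have ivt: "\<exists>c\<le>m. s c = x" if "a \<le> m" "b \<le> m" "s a \<le> x" "x \<le> s b" for a b x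
  proof (cases "a \<le> b")
    case True
    have "\<forall>i. a \<le> i \<and> i < b \<longrightarrow> \<bar>s (Suc i) - s i\<bar> \<le> 1" using lip \<open>b \<le> m\<close> by auto
    from nat_intermed_int_val[OF this True that(3,4)] show ?thesis
      using \<open>b \<le> m\<close> order_trans by blast
  next
    case False
    \<comment> \<open>The larger value comes first here, so the intermediate value property is
      applied to \<open>- s\<close>.\<close>
    have "\<forall>i. b \<le> i \<and> i < a \<longrightarrow> \<bar>- s (Suc i) - - s i\<bar> \<le> 1"
    proof (intro allI impI)
      fix i assume "b \<le> i \<and> i < a"
      then show "\<bar>- s (Suc i) - - s i\<bar> \<le> 1" using lip[of i] \<open>a \<le> m\<close> by linarith
    qed
    from nat_intermed_int_val[OF this, of "- x"] False that(3,4)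
    obtain c where "c \<le> a" "- s c = - x" by auto
    then show ?thesis using \<open>a \<le> m\<close> by (intro exI[of _ c]) auto
  qed
  have sums: "(\<Sum>i\<le>m. g (xs ! i)) = (\<Sum>i\<le>m. g (s i))" for g :: "int \<Rightarrow> int"
  proof -
    have "(\<Sum>i\<le>m. g (xs ! i)) = sum_list (map g xs)"
      by (simp add: sum_list_sum_nth len atLeast0LessThan lessThan_Suc_atMost)
    also have "\<dots> = sum_list (map g (map s [0..<Suc m]))"
      by (simp only: sum_mset_sum_list[symmetric] mset_map xs_def mset_sort)
    also have "\<dots> = (\<Sum>i\<le>m. g (s i))"
      by (simp add: interv_sum_list_conv_sum_set_nat comp_def atLeast0LessThan lessThan_Suc_atMost
          del: upt_Suc sum.lessThan_Suc)
    finally show ?thesis .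
  qed
  have srt: "xs ! i \<le> xs ! j" if "i \<le> j" "j \<le> m" for i j
    using that len by (intro sorted_nth_mono) (auto simp: xs_def)
  have "steps_in m {0, 1} (\<lambda>i. xs ! i)"
    unfolding steps_in_def
  proof (intro allI impI)
    fix i assume i: "i < m"
    have "xs ! Suc i \<le> xs ! i + 1"
    proof (rule ccontr)
      \<comment> \<open>A larger jump would skip \<open>xs ! i + 1\<close>, a value that
        \<open>s\<close> attains and for which sortedness leaves no index.\<close>
      assume gap: "\<not> ?thesis"
      have "xs ! i \<in> s ` {..m}" "xs ! Suc i \<in> s ` {..m}"
        using i len by (auto simp flip: set)
      then obtain a b where "a \<le> m" "b \<le> m" "s a = xs ! i" "s b = xs ! Suc i" by force
      then obtain c where "c \<le> m" "s c = xs ! i + 1" using ivt[of a b "xs ! i + 1"] gap by force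
      then have "xs ! i + 1 \<in> set xs" unfolding set by force
      then obtain j where j: "j \<le> m" "xs ! j = xs ! i + 1"
        using len by (auto simp: in_set_conv_nth less_Suc_eq_le)
      then show False
        using srt[of j i] srt[of "Suc i" j] i gap by (cases "j \<le> i") auto
    qed
    then show "xs ! Suc i - xs ! i \<in> {0, 1}" using srt[of i "Suc i"] i by auto
  qed
  with sums show ?thesis by (rule that[rotated])
qed

section \<open>Upper bound for the distance from 0\<close>

lemma sum_max_left:
  "p \<le> m \<Longrightarrow> 2 * (\<Sum>i\<le>m. max 0 (int p - int i)) = int p * (int p + 1)"
proof (induction p)
  case (Suc p)
  have "(\<Sum>i\<le>m. max 0 (int (Suc p) - int i)) = (\<Sum>i\<le>m. max 0 (int p - int i) + (if i \<in> {..p} then 1 else 0))"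
    by (rule sum.cong) auto
  also have "\<dots> = (\<Sum>i\<le>m. max 0 (int p - int i)) + (\<Sum>i\<in>{..m} \<inter> {..p}. 1)"
    by (simp only: sum.distrib sum.inter_restrict[OF finite_atMost])
  also have "{..m} \<inter> {..p} = {..p}" using Suc.prems by auto
  finally show ?case using Suc by (simp add: algebra_simps)
qed simp

lemma sum_reflect:
  fixes g :: "nat \<Rightarrow> int"
  shows "(\<Sum>i\<le>m. g (m - i)) = (\<Sum>i\<le>m. g i)"
  by (rule sum.reindex_bij_witness[of _ "\<lambda>i. m - i" "\<lambda>i. m - i"]) auto

text \<open>The two sides of p contribute the triangular numbers of p and m - p. Sums are doubled
  here and below to avoid division.\<close>

lemma sum_abs_dist:
  assumes "p \<le> m"
  shows "2 * (\<Sum>i\<le>m. \<bar>int i - int p\<bar>) = int p * (int p + 1) + int (m - p) * (int (m - p) + 1)"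
proof -
  have "(\<Sum>i\<le>m. \<bar>int i - int p\<bar>) = (\<Sum>i\<le>m. max 0 (int p - int i) + max 0 (int (m - p) - int (m - i)))"
    by (rule sum.cong) (use assms in \<open>auto simp: of_nat_diff\<close>)
  also have "\<dots> = (\<Sum>i\<le>m. max 0 (int p - int i)) + (\<Sum>i\<le>m. max 0 (int (m - p) - int i))"
    by (simp only: sum.distrib sum_reflect[of "\<lambda>i. max 0 (int (m - p) - int i)"])
  finally show ?thesis using sum_max_left[of p m] sum_max_left[of "m - p" m] assms by simp
qed

lemma steps_bounds:
  assumes "steps_in m {0, 1} u" "i \<le> j" "j \<le> m"
  shows "u i \<le> u j" "u j \<le> u i + int (j - i)"
proof -
  have "u i \<le> u j \<and> u j \<le> u i + int (j - i)"
    using assms(2,3)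
  proof (induction j rule: dec_induct)
    case (step k)
    then have "u (Suc k) - u k \<in> {0, 1}" using assms(1) by (simp add: steps_in_def)
    with step show ?case by (auto simp: Suc_diff_le)
  qed simp
  then show "u i \<le> u j" "u j \<le> u i + int (j - i)" by auto
qed

lemma steps_in_reflect:
  assumes "steps_in m {0, 1} u"
  shows "steps_in m {0, 1} (\<lambda>i. c - u (m - i))"
  unfolding steps_in_def
proof (intro allI impI)
  fix i assume "i < m"
  then have "m - Suc i < m" "Suc (m - Suc i) = m - i" by auto
  then have "u (m - i) - u (m - Suc i) \<in> {0, 1}"
    using assms unfolding steps_in_def by metis
  then show "c - u (m - Suc i) - (c - u (m - i)) \<in> {0, 1}" by auto
qed

text \<open>p counts the negative entries. Steps of at most one keep the negative part below the
  staircase p, p - 1, ..., 1. If p > 0, the sequence equals 0 at index p and stays within |i - p|;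
  if p = 0 it may start far above 0, so the second bound is conditional.\<close>

lemma zero_crossing:
  assumes u: "steps_in m {0, 1} u" and h: "h \<le> m" "u h \<ge> 0"
  obtains p where "p \<le> h" "2 * (\<Sum>i\<le>m. max 0 (- u i)) \<le> int p * (int p + 1)"
    "p > 0 \<Longrightarrow> 2 * (\<Sum>i\<le>m. \<bar>u i\<bar>) \<le> int p * (int p + 1) + int (m - p) * (int (m - p) + 1)"
proof -
  define p where "p = (LEAST p. u p \<ge> 0)"
  have up: "u p \<ge> 0" unfolding p_def by (rule LeastI) (rule h)
  have ph: "p \<le> h" unfolding p_def by (rule Least_le) (rule h)
  have neg: "u i < 0" if "i < p" for i
    using not_less_Least[of i "\<lambda>p. u p \<ge> 0"] that by (simp add: p_def)
  have "max 0 (- u i) \<le> max 0 (int p - int i)" if "i \<le> m" for i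
  proof (cases "i < p")
    case True
    then show ?thesis using steps_bounds[OF u, of i p] up ph h(1) by auto
  next
    case False
    then show ?thesis using steps_bounds[OF u, of p i] up that by auto
  qed
  then have "(\<Sum>i\<le>m. max 0 (- u i)) \<le> (\<Sum>i\<le>m. max 0 (int p - int i))"
    by (intro sum_mono) auto
  moreover have "2 * (\<Sum>i\<le>m. \<bar>u i\<bar>) \<le> int p * (int p + 1) + int (m - p) * (int (m - p) + 1)" if "p > 0"
  proof -
    have "u p = 0"
      using steps_bounds(2)[OF u, of "p - 1" p] neg[of "p - 1"] up that ph h(1) by auto
    then have "\<bar>u i\<bar> \<le> \<bar>int i - int p\<bar>" if "i \<le> m" for i
      using steps_bounds[OF u, of i p] steps_bounds[OF u, of p i] that ph h(1)
      by (cases "i \<le> p") auto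
    then have "(\<Sum>i\<le>m. \<bar>u i\<bar>) \<le> (\<Sum>i\<le>m. \<bar>int i - int p\<bar>)" by (intro sum_mono) auto
    then show ?thesis using sum_abs_dist[of p m] ph h(1) by simp
  qed
  ultimately show ?thesis using that[of p] sum_max_left[of p m] ph h(1) by force
qed

text \<open>The left side is convex in p and symmetric about m / 2, hence largest at the ends of
  [a, m - a]; the difference of the two sides is 2 (p - a) (m - a - p).\<close>

lemma triangle_sum_mono:
  fixes a p m :: int
  assumes "a \<le> p" "p \<le> m - a"
  shows "p * (p + 1) + (m - p) * (m - p + 1) \<le> a * (a + 1) + (m - a) * (m - a + 1)"
proof -
  have "0 \<le> (p - a) * (m - a - p)" using assms by simp
  then show ?thesis by (simp add: algebra_simps)
qed

text \<open>t is a cutoff for the numbers of entries below 0 and above n. A number past the cutoff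
  is at least A, and convexity with \<open>b1\<close> bounds one distance. Otherwise
  \<open>b2\<close> bounds the sum of the distances to 0 and to n by 2 b + 1, so one of these two
  integers is at most b.\<close>

lemma min_distance_le:
  fixes n m A t b :: nat
  assumes n: "n \<ge> 1" and s: "steps_in m S s" "S \<subseteq> {-1, 0, 1}"
    and A: "A \<le> Suc t" "2 * A \<le> m"
    and b1: "A * (A + 1) + (m - A) * (m - A + 1) \<le> 2 * b"
    and b2: "n * (m + 1) + 2 * (t * (t + 1)) \<le> 2 * b + 1"
  shows "\<exists>k. (\<Sum>i\<le>m. \<bar>s i + k * int n\<bar>) \<le> int b"
proof -
  obtain u0 where u0: "steps_in m {0, 1} u0"
    and sums: "\<And>g :: int \<Rightarrow> int. (\<Sum>i\<le>m. g (u0 i)) = (\<Sum>i\<le>m. g (s i))"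
    by (rule sorted_rearrangement[OF s]) blast
  \<comment> \<open>Subtracting \<open>c * int n\<close> puts the median \<open>u h\<close> into [0,
    n). Hence at most h entries are below 0 and at most m - h above n, and both limits are at most m
    - A.\<close>
  define h where "h = m div 2"
  define c where "c = u0 h div int n"
  define u where "u i = u0 i - c * int n" for i
  have u: "steps_in m {0, 1} u" using u0 by (simp add: steps_in_def u_def)
  have "u h = u0 h mod int n" by (simp add: u_def c_def minus_div_mult_eq_mod)
  then have uh: "0 \<le> u h" "u h < int n" using n by simp_all
  have hm: "h \<le> m" "A \<le> h" "A \<le> m - h" "h \<le> m - A" using A by (auto simp: h_def)
  have b1': "int A * (int A + 1) + (int m - int A) * (int m - int A + 1) \<le> 2 * int b"
  proof -
    obtain d where d: "m = A + d" using hm by (metis le_add_diff_inverse le_trans)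
    then have "int (A * (A + 1) + d * (d + 1)) \<le> int (2 * b)" using b1 by (simp only: of_nat_le_iff) simp
    with d show ?thesis by (simp add: algebra_simps)
  qed
  have b2': "int n * (int m + 1) + 2 * (int t * (int t + 1)) \<le> 2 * int b + 1"
  proof -
    have "int (n * (m + 1) + 2 * (t * (t + 1))) \<le> int (2 * b + 1)" using b2 by (simp only: of_nat_le_iff)
    then show ?thesis by (simp add: algebra_simps)
  qed
  have outer: "(\<Sum>i\<le>m. \<bar>v i\<bar>) \<le> int b"
    if "t < p" "p \<le> m - A"
      "2 * (\<Sum>i\<le>m. \<bar>v i\<bar>) \<le> int p * (int p + 1) + int (m - p) * (int (m - p) + 1)" for v and p
  proof -
    have "int A \<le> int p" "int p \<le> int m - int A" and mp: "int (m - p) = int m - int p"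
      using that A(1) hm by linarith+
    then have "int p * (int p + 1) + (int m - int p) * (int m - int p + 1) \<le> 2 * int b"
      using triangle_sum_mono[of "int A" "int p" "int m"] b1' by linarith
    then show ?thesis using that(3) unfolding mp by linarith
  qed
  obtain p where p: "p \<le> h" "2 * (\<Sum>i\<le>m. max 0 (- u i)) \<le> int p * (int p + 1)"
    "p > 0 \<Longrightarrow> 2 * (\<Sum>i\<le>m. \<bar>u i\<bar>) \<le> int p * (int p + 1) + int (m - p) * (int (m - p) + 1)"
    using zero_crossing[OF u hm(1) uh(1)] by blast
  \<comment> \<open>Reversing the order and replacing u by n - u turns entries above n into negative
    ones, so \<open>zero_crossing\<close> applies again.\<close>
  have "\<exists>q\<le>m - h. 2 * (\<Sum>i\<le>m. max 0 (u i - int n)) \<le> int q * (int q + 1) \<and>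
    (q > 0 \<longrightarrow> 2 * (\<Sum>i\<le>m. \<bar>u i - int n\<bar>) \<le> int q * (int q + 1) + int (m - q) * (int (m - q) + 1))"
  proof -
    let ?w = "\<lambda>i. int n - u (m - i)"
    have "?w (m - h) \<ge> 0" using uh(2) hm(1) by simp
    then obtain q where "q \<le> m - h" "2 * (\<Sum>i\<le>m. max 0 (- ?w i)) \<le> int q * (int q + 1)"
      "q > 0 \<Longrightarrow> 2 * (\<Sum>i\<le>m. \<bar>?w i\<bar>) \<le> int q * (int q + 1) + int (m - q) * (int (m - q) + 1)"
      using zero_crossing[OF steps_in_reflect[OF u, of "int n"], of "m - h"] by auto
    then show ?thesis
      using sum_reflect[of "\<lambda>i. max 0 (u i - int n)" m] sum_reflect[of "\<lambda>i. \<bar>int n - u i\<bar>" m]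
      by (auto simp: abs_minus_commute)
  qed
  then obtain q where q: "q \<le> m - h" "2 * (\<Sum>i\<le>m. max 0 (u i - int n)) \<le> int q * (int q + 1)"
    "q > 0 \<Longrightarrow> 2 * (\<Sum>i\<le>m. \<bar>u i - int n\<bar>) \<le> int q * (int q + 1) + int (m - q) * (int (m - q) + 1)"
    by blast
  have "(\<Sum>i\<le>m. \<bar>u i\<bar>) \<le> int b \<or> (\<Sum>i\<le>m. \<bar>u i - int n\<bar>) \<le> int b"
  proof -
    consider "t < p" | "t < q" | "p \<le> t" "q \<le> t" by linarith
    then show ?thesis
    proof cases
      case 1 then show ?thesis using outer[of p u] p hm by auto
    next
      case 2 then show ?thesis using outer[of q "\<lambda>i. u i - int n"] q hm by auto
    next
      case 3
      \<comment> \<open>Termwise, |x| + |x - n| is n plus twice the amount by which x lies outside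
        [0, n].\<close>
      have "(\<Sum>i\<le>m. \<bar>u i\<bar>) + (\<Sum>i\<le>m. \<bar>u i - int n\<bar>)
          = (\<Sum>i\<le>m. int n + 2 * max 0 (- u i) + 2 * max 0 (u i - int n))"
        unfolding sum.distrib[symmetric] by (rule sum.cong) (auto simp: max_def)
      also have "\<dots> = int n * (int m + 1) + 2 * (\<Sum>i\<le>m. max 0 (- u i)) + 2 * (\<Sum>i\<le>m. max 0 (u i - int n))"
        by (simp add: sum.distrib sum_distrib_left algebra_simps)
      also have "\<dots> \<le> int n * (int m + 1) + int p * (int p + 1) + int q * (int q + 1)"
        using p(2) q(2) by linarith
      also have "int p * (int p + 1) \<le> int t * (int t + 1)" using 3 by (intro mult_mono) auto
      also have "int q * (int q + 1) \<le> int t * (int t + 1)" using 3 by (intro mult_mono) auto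
      finally show ?thesis using b2' by linarith
    qed
  qed
  \<comment> \<open>This undoes the sorting and the translation; the shifts -c and -c - 1 of
    \<open>s\<close> yield the two sums.\<close>
  moreover have "(\<Sum>i\<le>m. \<bar>s i + k * int n\<bar>) = (\<Sum>i\<le>m. \<bar>u i + (k + c) * int n\<bar>)" for k
    using sums[of "\<lambda>x. \<bar>x + k * int n\<bar>"] by (simp add: u_def algebra_simps)
  from this[of "- c"] this[of "- c - 1"]
  have "(\<Sum>i\<le>m. \<bar>s i + - c * int n\<bar>) = (\<Sum>i\<le>m. \<bar>u i\<bar>)"
    "(\<Sum>i\<le>m. \<bar>s i + (- c - 1) * int n\<bar>) = (\<Sum>i\<le>m. \<bar>u i - int n\<bar>)" by auto
  ultimately show ?thesis by metis
qed

section \<open>Lower bounds from explicit sequences\<close>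

text \<open>An upward shift by x raises each term from index h on by exactly x and lowers each of
  the first h by at most x; these are at most half of all m + 1 terms.\<close>

lemma sum_abs_shift_ge:
  fixes w :: "nat \<Rightarrow> int"
  assumes "\<And>i. \<lbrakk>h \<le> i; i \<le> m\<rbrakk> \<Longrightarrow> w i \<ge> 0" "2 * h \<le> m + 1" "x \<ge> 0"
  shows "(\<Sum>i\<le>m. \<bar>w i\<bar>) \<le> (\<Sum>i\<le>m. \<bar>w i + x\<bar>)"
proof -
  have "(\<Sum>i\<le>m. \<bar>w i\<bar>) + x * (int (m + 1) - 2 * int h) = (\<Sum>i\<le>m. \<bar>w i\<bar> + (x - (if i \<in> {..<h} then 2 * x else 0)))"
  proof -
    have "(\<Sum>i\<le>m. if i \<in> {..<h} then 2 * x else 0) = (\<Sum>i\<in>{..m} \<inter> {..<h}. 2 * x)"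
      by (simp only: sum.inter_restrict[OF finite_atMost])
    also have "{..m} \<inter> {..<h} = {..<h}" using assms(2) by auto
    finally show ?thesis by (simp add: sum.distrib sum_subtractf algebra_simps)
  qed
  also have "\<dots> \<le> (\<Sum>i\<le>m. \<bar>w i + x\<bar>)"
    by (rule sum_mono) (use assms(1,3) in \<open>auto simp: not_less\<close>)
  finally have "(\<Sum>i\<le>m. \<bar>w i\<bar>) + x * (int (m + 1) - 2 * int h) \<le> (\<Sum>i\<le>m. \<bar>w i + x\<bar>)" .
  moreover have "0 \<le> x * (int (m + 1) - 2 * int h)" using assms(2,3) by simp
  ultimately show ?thesis by linarith
qed

text \<open>The conditions \<open>lo\<close> and \<open>hi\<close> put a median into [0, n], so only
  the shifts k = 0 and k = -1 need a bound. Larger k shift w further up; smaller k shift the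
  reflected sequence n - w further up by (-k - 1) n.\<close>

lemma median_witness:
  fixes w :: "nat \<Rightarrow> int"
  assumes lo: "\<And>i. \<lbrakk>h \<le> i; i \<le> m\<rbrakk> \<Longrightarrow> w i \<ge> 0" and hi: "\<And>i. i + h' \<le> m \<Longrightarrow> w i \<le> int n"
    and h: "2 * h \<le> m + 1" "2 * h' \<le> m + 1"
    and b: "b \<le> (\<Sum>i\<le>m. \<bar>w i\<bar>)" "b \<le> (\<Sum>i\<le>m. \<bar>int n - w i\<bar>)"
  shows "b \<le> (\<Sum>i\<le>m. \<bar>w i + k * int n\<bar>)"
proof (cases "k \<ge> 0")
  case True
  then show ?thesis using sum_abs_shift_ge[of h m w "k * int n"] lo h b by force
next
  case False
  have "(\<Sum>i\<le>m. \<bar>int n - w (m - i)\<bar>) \<le> (\<Sum>i\<le>m. \<bar>int n - w (m - i) + (- k - 1) * int n\<bar>)"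
    by (rule sum_abs_shift_ge[of h']) (use hi h False in auto)
  also have "\<dots> = (\<Sum>i\<le>m. \<bar>int n - w i + (- k - 1) * int n\<bar>)"
    by (rule sum_reflect)
  also have "\<dots> = (\<Sum>i\<le>m. \<bar>w i + k * int n\<bar>)"
    by (rule sum.cong) (auto simp: algebra_simps abs_minus_commute)
  finally show ?thesis using b(2) sum_reflect[of "\<lambda>i. \<bar>int n - w i\<bar>" m] by simp
qed

lemma two_choose_two: "2 * (Suc x choose 2) = x * (x + 1)"
  by (simp add: choose_two)

text \<open>The values -A, ..., m - A have A entries below 0 and either A or A - 1 above n. So the
  distance to n is at least the distance to 0, which is b.\<close>

lemma consecutive_witness:
  fixes n m A b :: nat
  assumes A: "2 * A + n = m \<or> 2 * A + n = m + 1" "A + n \<le> m"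
    and b: "2 * b = A * (A + 1) + (m - A) * (m - A + 1)"
  shows "int b \<le> (\<Sum>i\<le>m. \<bar>int i - int A + k * int n\<bar>)"
proof (rule median_witness[of A m _ "m - A - n"])
  have Am: "A \<le> m" using A by auto
  have "2 * int b = int A * (int A + 1) + int (m - A) * (int (m - A) + 1)"
    using arg_cong[OF b, of int] by (simp only: of_nat_mult of_nat_add of_nat_1 of_nat_numeral)
  then have b': "(\<Sum>i\<le>m. \<bar>int i - int A\<bar>) = int b"
    using sum_abs_dist[of A m] Am by simp
  then show "int b \<le> (\<Sum>i\<le>m. \<bar>int i - int A\<bar>)" by simp
  have "2 * (\<Sum>i\<le>m. \<bar>int i - int A\<bar>) \<le> 2 * (\<Sum>i\<le>m. \<bar>int i - int (A + n)\<bar>)"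
  proof -
    have "int m - int (A + n) \<le> int A" and d: "int (m - A) = int m - int A" "int (m - (A + n)) = int m - int (A + n)"
      using A by linarith+
    then show ?thesis
      using triangle_sum_mono[of "int m - int (A + n)" "int A" "int m"]
      unfolding sum_abs_dist[OF Am] sum_abs_dist[OF A(2)] d by (simp add: add.commute)
  qed
  also have "(\<Sum>i\<le>m. \<bar>int i - int (A + n)\<bar>) = (\<Sum>i\<le>m. \<bar>int n - (int i - int A)\<bar>)"
    by (rule sum.cong) (auto simp: abs_minus_commute algebra_simps)
  finally show "int b \<le> (\<Sum>i\<le>m. \<bar>int n - (int i - int A)\<bar>)" using b' by simp
qed (use A in auto)

text \<open>Evaluates a sequence of consecutive values in which c occurs twice: the repetition costs
  one extra term.\<close>

lemma sum_repeat:
  fixes g :: "nat \<Rightarrow> int"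
  assumes "c \<le> M"
  shows "(\<Sum>i\<le>Suc M. g (if i \<le> c then i else i - 1)) = (\<Sum>i\<le>M. g i) + g c"
  using assms
proof (induction M rule: dec_induct)
  case base
  have "(\<Sum>i\<le>c. g (if i \<le> c then i else i - 1)) = (\<Sum>i\<le>c. g i)" by (rule sum.cong) auto
  then show ?case by simp
next
  case (step M)
  then show ?case by simp
qed

section \<open>Eccentricity for m at most n, and for m - n even or odd\<close>

context
  fixes n :: nat and S :: "int set"
  assumes n: "n \<ge> 1" and S: "S = {0, 1} \<or> S = {-1, 0, 1}"
begin

lemma ecc_gen_le:
  assumes "m \<le> n"
  shows "ecc (gen_verts n m S) (gen_adj n m S) (zero_vertex m) = enat (n * (m + 1) div 2)"
proof (rule ecc_gen_eqI[OF n S])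
  fix s assume "steps_in m S s"
  moreover have "S \<subseteq> {-1, 0, 1}" using S by auto
  ultimately show "\<exists>k. (\<Sum>i\<le>m. \<bar>s i + k * int n\<bar>) \<le> int (n * (m + 1) div 2)"
  proof (rule min_distance_le[OF n, where A = 0 and t = 0])
    \<comment> \<open>Since m (m + 1) is even, rounding n (m + 1) / 2 down does not break the
      bound.\<close>
    have "m * (m + 1) \<le> n * (m + 1)" using assms by (intro mult_right_mono) auto
    moreover have "even (m * (m + 1))" by simp
    moreover have "x \<le> 2 * (y div 2)" if "x \<le> y" "even x" for x y :: nat using that by presburger
    ultimately show "0 * (0 + 1) + (m - 0) * (m - 0 + 1) \<le> 2 * (n * (m + 1) div 2)"
      by (metis add_0 diff_zero mult_zero_left)
  qed auto
next
  \<comment> \<open>The witness stays as close to n / 2 as possible: the floor of n / 2 on the first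
    c positions, the ceiling on the rest, with c the rounded-up half of m + 1. The distances to 0
    and n add up to n (m + 1) and differ by at most one.\<close>
  define c where "c = (m + 2) div 2"
  define w where "w i = (if i < c then int (n div 2) else int n - int (n div 2))" for i
  show "steps_in m {0, 1} w" unfolding steps_in_def w_def by auto
  have sum_w: "(\<Sum>i\<le>m. if i < c then x else y) = int c * x + int (m + 1 - c) * y" for x y :: int
  proof -
    have "c \<le> m + 1" by (simp add: c_def)
    then have "{i. i \<le> m \<and> i < c} = {..<c}" "{i. i \<le> m \<and> \<not> i < c} = {c..<m + 1}" by auto
    then show ?thesis by (simp add: sum.If_cases Collect_conj_eq[symmetric] Int_def Compl_eq)
  qed
  have w0: "0 \<le> w i" "w i \<le> int n" for i by (auto simp: w_def)
  have ineq: "int (n * (m + 1) div 2) \<le> int c * int (n div 2) + int (m + 1 - c) * (int n - int (n div 2))"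
    "int (n * (m + 1) div 2) \<le> int c * (int n - int (n div 2)) + int (m + 1 - c) * int (n div 2)"
  proof -
    define d where "d = m + 1 - c"
    have cd: "m + 1 = c + d" "d \<le> c" "d = (m + 1) div 2" unfolding d_def c_def by presburger+
    define f where "f = n div 2"
    have "n = 2 * f \<or> n = 2 * f + 1" unfolding f_def by presburger
    then have "int (n * (m + 1) div 2) \<le> int c * int f + int d * (int n - int f)
      \<and> int (n * (m + 1) div 2) \<le> int c * (int n - int f) + int d * int f"
    proof
      assume "n = 2 * f"
      then show ?thesis unfolding cd(1) by (simp add: algebra_simps)
    next
      assume nf: "n = 2 * f + 1"
      have "n * (m + 1) = (m + 1) + (f * (m + 1)) * 2" unfolding nf by (simp add: algebra_simps)
      then have "n * (m + 1) div 2 = f * (m + 1) + (m + 1) div 2" by (simp only: div_mult_self1)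
      also have "\<dots> = f * (c + d) + d" using cd by simp
      finally show ?thesis using nf cd(2) by (simp add: algebra_simps)
    qed
    then show "int (n * (m + 1) div 2) \<le> int c * int (n div 2) + int (m + 1 - c) * (int n - int (n div 2))"
      "int (n * (m + 1) div 2) \<le> int c * (int n - int (n div 2)) + int (m + 1 - c) * int (n div 2)"
      by (simp_all only: d_def f_def)
  qed
  fix k
  show "int (n * (m + 1) div 2) \<le> (\<Sum>i\<le>m. \<bar>w i + k * int n\<bar>)"
  proof (rule median_witness[of 0 m w 0])
    have "(\<Sum>i\<le>m. \<bar>w i\<bar>) = (\<Sum>i\<le>m. if i < c then int (n div 2) else int n - int (n div 2))"
      by (rule sum.cong) (auto simp: w_def)
    then show "int (n * (m + 1) div 2) \<le> (\<Sum>i\<le>m. \<bar>w i\<bar>)" using ineq by (simp only: sum_w)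
    have "(\<Sum>i\<le>m. \<bar>int n - w i\<bar>) = (\<Sum>i\<le>m. if i < c then int n - int (n div 2) else int (n div 2))"
      by (rule sum.cong) (auto simp: w_def)
    then show "int (n * (m + 1) div 2) \<le> (\<Sum>i\<le>m. \<bar>int n - w i\<bar>)" using ineq by (simp only: sum_w)
  qed (use w0 in auto)
qed

text \<open>With A = t the two bounds of \<open>min_distance_le\<close> give the same number. It is
  reached by -t, ..., n + t, which is symmetric about n / 2.\<close>

lemma ecc_gen_diff_even:
  assumes m: "m = n + 2 * t"
  shows "ecc (gen_verts n m S) (gen_adj n m S) (zero_vertex m)
    = enat ((Suc (n + t) choose 2) + (Suc t choose 2))" (is "_ = enat ?b")
proof (rule ecc_gen_eqI[OF n S])
  have b: "2 * ?b = t * (t + 1) + (n + t) * (n + t + 1)"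
    by (simp only: distrib_left two_choose_two add.commute)
  have mt: "m - t = n + t" using m by simp
  show "\<exists>k. (\<Sum>i\<le>m. \<bar>s i + k * int n\<bar>) \<le> int ?b" if s: "steps_in m S s" for s
  proof (rule min_distance_le[OF n s, where A = t and t = t])
    show "t * (t + 1) + (m - t) * (m - t + 1) \<le> 2 * ?b" unfolding b mt by simp
    show "n * (m + 1) + 2 * (t * (t + 1)) \<le> 2 * ?b + 1"
      unfolding b m by (simp add: algebra_simps)
  qed (use m S in auto)
  show "steps_in m {0, 1} (\<lambda>i. int i - int t)" by (simp add: steps_in_def)
  show "int ?b \<le> (\<Sum>i\<le>m. \<bar>int i - int t + k * int n\<bar>)" for k
  proof (rule consecutive_witness)
    show "2 * ?b = t * (t + 1) + (m - t) * (m - t + 1)" unfolding b mt by (rule refl)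
  qed (use m in auto)
qed

text \<open>With A = t + 1 the convexity bound gives \<open>b1\<close> and the averaging bound,
  rounded down, gives \<open>b2\<close>. Either can be the larger, and each has its own witness when
  it is.\<close>

lemma ecc_gen_diff_odd:
  assumes m: "m = n + 2 * t + 1"
  shows "ecc (gen_verts n m S) (gen_adj n m S) (zero_vertex m)
    = enat ((Suc (n + t) choose 2) + max (Suc (Suc t) choose 2) ((Suc t choose 2) + n div 2))"
    (is "_ = enat ?b")
proof -
  define b1 where "b1 = (Suc (n + t) choose 2) + (Suc (Suc t) choose 2)"
  define b2 where "b2 = (Suc (n + t) choose 2) + (Suc t choose 2) + n div 2"
  have b1: "2 * b1 = (t + 1) * (t + 1 + 1) + (n + t) * (n + t + 1)"
    unfolding b1_def distrib_left two_choose_two by simp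
  have b2: "2 * b2 = t * (t + 1) + (n + t) * (n + t + 1) + 2 * (n div 2)"
    unfolding b2_def distrib_left two_choose_two by simp
  have b: "?b = max b1 b2" by (simp add: b1_def b2_def)
  have upper: "\<exists>k. (\<Sum>i\<le>m. \<bar>s i + k * int n\<bar>) \<le> int (max b1 b2)" if s: "steps_in m S s" for s
  proof (rule min_distance_le[OF n s, where A = "t + 1" and t = t])
    have "m - (t + 1) = n + t" using m by simp
    then have "(t + 1) * (t + 1 + 1) + (m - (t + 1)) * (m - (t + 1) + 1) = 2 * b1"
      unfolding b1 by simp
    then show "(t + 1) * (t + 1 + 1) + (m - (t + 1)) * (m - (t + 1) + 1) \<le> 2 * max b1 b2" by simp
    have "n \<le> 2 * (n div 2) + 1" by presburger
    then have "n * (m + 1) + 2 * (t * (t + 1)) \<le> 2 * b2 + 1"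
      unfolding b2 m by (simp add: algebra_simps)
    then show "n * (m + 1) + 2 * (t * (t + 1)) \<le> 2 * max b1 b2 + 1" by simp
  qed (use m S n in auto)
  show ?thesis
  \<comment> \<open>The difference b1 - b2 is t + 1 - n div 2.\<close>
  proof (cases "b2 \<le> b1")
    case True
    have "ecc (gen_verts n m S) (gen_adj n m S) (zero_vertex m) = enat b1"
    proof (rule ecc_gen_eqI[OF n S])
      show "steps_in m {0, 1} (\<lambda>i. int i - int (t + 1))" by (simp add: steps_in_def)
      have mt: "m - (t + 1) = n + t" using m by simp
      show "int b1 \<le> (\<Sum>i\<le>m. \<bar>int i - int (t + 1) + k * int n\<bar>)" for k
      proof (rule consecutive_witness)
        show "2 * b1 = (t + 1) * (t + 1 + 1) + (m - (t + 1)) * (m - (t + 1) + 1)"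
          unfolding b1 mt by (rule refl)
      qed (use m n in auto)
    qed (use upper True in \<open>simp add: max_absorb1\<close>)
    with b True show ?thesis by (simp add: max_absorb1)
  next
    case False
    (* Repeating the value n div 2 instead of including the value - t - 1 brings the distances
       to 0 and to n within one of each other. *)
    define c where "c = t + n div 2"
    define w where "w i = int (if i \<le> c then i else i - 1) - int t" for i
    define M where "M = n + 2 * t"
    have mM: "m = Suc M" "c \<le> M" by (auto simp: m M_def c_def)
    have "ecc (gen_verts n m S) (gen_adj n m S) (zero_vertex m) = enat b2"
    proof (rule ecc_gen_eqI[OF n S])
      show "steps_in m {0, 1} w" by (auto simp: steps_in_def w_def)
      fix k
      show "int b2 \<le> (\<Sum>i\<le>m. \<bar>w i + k * int n\<bar>)"
      proof (rule median_witness[of t m w t])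
        have b2': "2 * int b2 = int t * (int t + 1) + int (n + t) * (int (n + t) + 1) + 2 * int (n div 2)"
          using arg_cong[OF b2, of int] by (simp add: algebra_simps)
        have M: "M - t = n + t" "M - (n + t) = t" by (auto simp: M_def)
        \<comment> \<open>Without the repetition the values are -t, ..., n + t; the repeated value
          adds n div 2 to the distance to 0 and n - n div 2 to the distance to n.\<close>
        have "(\<Sum>i\<le>m. \<bar>w i\<bar>) = (\<Sum>i\<le>M. \<bar>int i - int t\<bar>) + int (n div 2)"
          unfolding mM(1) w_def using sum_repeat[OF mM(2), of "\<lambda>i. \<bar>int i - int t\<bar>"]
          by (simp add: c_def)
        then show "int b2 \<le> (\<Sum>i\<le>m. \<bar>w i\<bar>)"
          using sum_abs_dist[of t M] b2' unfolding M by (simp add: M_def)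
        have "(\<Sum>i\<le>m. \<bar>int n - w i\<bar>) = (\<Sum>i\<le>M. \<bar>int i - int (n + t)\<bar>) + int (n - n div 2)"
          unfolding mM(1) w_def using sum_repeat[OF mM(2), of "\<lambda>i. \<bar>int n - (int i - int t)\<bar>"]
          by (simp add: c_def abs_minus_commute algebra_simps)
        then show "int b2 \<le> (\<Sum>i\<le>m. \<bar>int n - w i\<bar>)"
          using sum_abs_dist[of "n + t" M] b2' unfolding M by (simp add: M_def)
      qed (auto simp: w_def c_def m)
    qed (use upper False in \<open>simp add: max_absorb2\<close>)
    with b False show ?thesis by (simp add: max_absorb2)
  qed
qed

end

theorem theorem5p55:
  fixes n m :: nat
  assumes "n \<ge> 1"
  shows "ecc (dyoke_verts n m) (dyoke_adj n m) (zero_vertex m)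
           = ecc (yoke_verts n m) (yoke_adj n m) (zero_vertex m)
    \<and> (n = 1 \<longrightarrow> ecc (dyoke_verts n m) (dyoke_adj n m) (zero_vertex m)
           = enat ((((m + 1) div 2 + 1) choose 2) + ((m div 2 + 1) choose 2)))
    \<and> (m \<le> n \<longrightarrow> ecc (dyoke_verts n m) (dyoke_adj n m) (zero_vertex m)
           = enat (n * (m + 1) div 2))
    \<and> (2 \<le> n \<and> n \<le> m \<longrightarrow>
         (let d0 = (((m + n) div 2 + 1) choose 2) + (((m - n + 1) div 2 + 1) choose 2) in
           ((2 dvd (m - n) \<or> n \<le> (m + 2) div 2) \<longrightarrow>
              ecc (dyoke_verts n m) (dyoke_adj n m) (zero_vertex m) = enat d0)
         \<and> (\<not> (2 dvd (m - n) \<or> n \<le> (m + 2) div 2) \<longrightarrow>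
              ecc (dyoke_verts n m) (dyoke_adj n m) (zero_vertex m) = enat (d0 + n - (m + 2) div 2))))"
proof -
  let ?e = "ecc (dyoke_verts n m) (dyoke_adj n m) (zero_vertex m)"
  have both: "?e = x \<and> ecc (yoke_verts n m) (yoke_adj n m) (zero_vertex m) = x"
    if "\<And>S. S = {0, 1} \<or> S = {-1, 0, 1} \<Longrightarrow> ecc (gen_verts n m S) (gen_adj n m S) (zero_vertex m) = x"
    for x
    using that unfolding dyoke_verts_def dyoke_adj_def yoke_verts_def yoke_adj_def by simp
  \<comment> \<open>m = n falls under the second case with t = 0, so the formula for m at most n has
    to be matched there as well.\<close>
  consider "m < n" | t where "m = n + 2 * t" | t where "m = n + 2 * t + 1"
  proof -
    have "m = n + 2 * ((m - n) div 2) \<or> m = n + 2 * ((m - n) div 2) + 1" if "n \<le> m"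
      using that by presburger
    then show ?thesis using that by (meson not_less)
  qed
  then show ?thesis
  proof cases
    case 1
    have eq: "?e = enat (n * (m + 1) div 2)
      \<and> ecc (yoke_verts n m) (yoke_adj n m) (zero_vertex m) = enat (n * (m + 1) div 2)"
      by (rule both, rule ecc_gen_le[OF assms]) (use 1 in auto)
    show ?thesis using eq 1 by (auto simp: choose_two)
  next
    case (2 t)
    have eq: "?e = enat ((Suc (n + t) choose 2) + (Suc t choose 2))
      \<and> ecc (yoke_verts n m) (yoke_adj n m) (zero_vertex m) = enat ((Suc (n + t) choose 2) + (Suc t choose 2))"
      by (rule both, rule ecc_gen_diff_even[OF assms _ 2])
    have d0: "(m + n) div 2 + 1 = Suc (n + t)" "(m - n + 1) div 2 + 1 = Suc t" "2 dvd (m - n)"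
      using 2 by auto
    have one: "(m + 1) div 2 + 1 = Suc (n + t)" "m div 2 + 1 = Suc t" if "n = 1" using that 2 by auto
    have small: "(Suc (n + t) choose 2) + (Suc t choose 2) = n * (m + 1) div 2" if "m \<le> n"
      using that 2 by (simp add: choose_two mult.commute)
    show ?thesis
      unfolding Let_def d0 using eq one small d0(3) by auto
  next
    case (3 t)
    have "m + 2 = (n + 1) + Suc t * 2" using 3 by simp
    then have ceil: "(m + 2) div 2 = Suc t + (n + 1) div 2" by (simp only: div_mult_self1)
    have split: "n = n div 2 + (n + 1) div 2" by presburger
    have C: "Suc (Suc t) choose 2 = (Suc t choose 2) + Suc t" by (simp add: numeral_2_eq_2)
    define d where "d = (Suc (n + t) choose 2) + (Suc (Suc t) choose 2)"
    \<comment> \<open>The maximum in \<open>ecc_gen_diff_odd\<close> becomes a truncated difference: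
      n div 2 - (t + 1) equals n minus the ceiling of (m + 1) / 2 when that is positive, and 0
      otherwise. It thus covers (a) and (b) together.\<close>
    have "?e = enat (d + (n div 2 - Suc t))
      \<and> ecc (yoke_verts n m) (yoke_adj n m) (zero_vertex m) = enat (d + (n div 2 - Suc t))"
    proof (rule both)
      fix S :: "int set" assume "S = {0, 1} \<or> S = {-1, 0, 1}"
      from ecc_gen_diff_odd[OF assms this 3]
      show "ecc (gen_verts n m S) (gen_adj n m S) (zero_vertex m) = enat (d + (n div 2 - Suc t))"
        by (simp add: d_def C max_def)
    qed
    moreover have d0: "(m + n) div 2 + 1 = Suc (n + t)" "(m - n + 1) div 2 + 1 = Suc (Suc t)"
      and "\<not> 2 dvd (m - n)"
      using 3 by auto
    moreover have "(m + 1) div 2 + 1 = Suc (n + t)" "m div 2 + 1 = Suc (Suc t)" if "n = 1" using that 3 by auto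
    moreover have "n div 2 - Suc t = 0" if "n \<le> (m + 2) div 2"
      using that split unfolding ceil by linarith
    moreover have "d + (n div 2 - Suc t) = d + n - (m + 2) div 2" if "\<not> n \<le> (m + 2) div 2"
      using that split unfolding ceil by linarith
    moreover have "\<not> m \<le> n" using 3 by simp
    ultimately show ?thesis
      unfolding Let_def d0 d_def[symmetric] by (auto simp: d_def)
  qed
qed

end
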